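(* The no-slip billiard system on the infinite strip has no periodic orbits besides the trivial period-two orbit. That is, if an orbit (with nonzero vertical velocity $\dot x_2$) of the no-slip billiard of a disk between two parallel horizontal lines is periodic, then its velocity satisfies $\dot x_0=\dot x_1=0$, so that it is the vertical period-two orbit without rotation.
   Context: A disk of radius $R>0$ with uniform mass distribution moves in the plane between two fixed parallel horizontal walls. Its configuration is described by coordinates $(x_0,x_1,x_2)$, where $(x_1,x_2)$ is the position of the center ($x_1$ horizontal, $x_2$ vertical) and $x_0=\frac{R}{\sqrt2}\vartheta$, where $\vartheta$ is the angle of rotation of the disk (measured clockwise, when $x_1$ points right and $x_2$ points up). The center moves in a strip of positive width between two horizontal lines. Between collisions the velocity $v=(\dot x_0,\dot x_1,\dot x_2)$ is constant; a collision occurs when the center reaches a boundary line of this strip. No-slip collision: at a collision at a boundary point with unit normal $\nu\in\mathbb{R}^2$ pointing into the strip, let $\tau$ be $\nu$ rotated by $-\pi/2$ (so $\tau=(1,0)$ if $\nu=(0,1)$). Writing $v_0^\pm$ for the rotational component $\dot x_0$ and $w^\pm\in\mathbb{R}^2$ for the planar velocity $(\dot x_1,\dot x_2)$ before $(-)$ and after $(+)$ the collision, $$v_0^+=-\tfrac13 v_0^-+\tfrac{2\sqrt2}{3}\,w^-\cdot\tau,\qquad w^+=\left[\tfrac{2\sqrt2}{3}v_0^-+\tfrac13\,w^-\cdot\tau\right]\tau-(w^-\cdot\nu)\,\nu .$$ An orbit is recorded as the sequence of states at collisions, a state being the position of the center together with the post-collision velocity $v\in\mathbb{R}^3$ (the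 angle of rotation itself is disregarded). An orbit is periodic of period $p\ge 1$ if the state recurs after $p$ collisions. *)

theory Defs
  imports "HOL-Analysis.Analysis"
begin

text \<open>
  Velocities are triples \<open>(dx\<^sub>0, dx\<^sub>1, dx\<^sub>2)\<close>, i.e. pairs of the rotational component
  \<open>dx\<^sub>0 = R / sqrt 2 * d\<theta>\<close> (clockwise angle \<open>\<theta>\<close>) and the planar velocity of the center.
  The mass distribution and the radius enter the collision law only through this choice of
  rotational coordinate.
\<close>

type_synonym plane = "real \<times> real"
type_synonym velocity = "real \<times> plane"

record billiard_state =
  center :: plane
  velocity :: velocity  \<comment> \<open>post-collision\<close>

abbreviation (input) rotational :: "velocity \<Rightarrow> real" where
  "rotational v \<equiv> fst v"

abbreviation (input) horizontal :: "velocity \<Rightarrow> real" where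
  "horizontal v \<equiv> fst (snd v)"

abbreviation (input) vertical :: "velocity \<Rightarrow> real" where
  "vertical v \<equiv> snd (snd v)"

definition rotate_right :: "plane \<Rightarrow> plane" where  \<comment> \<open>rotation by \<open>-\<pi>/2\<close>\<close>
  "rotate_right u = (snd u, - fst u)"

definition no_slip_collision :: "plane \<Rightarrow> velocity \<Rightarrow> velocity" where
  "no_slip_collision \<nu> v =
     (let \<tau> = rotate_right \<nu>; v0 = fst v; w = snd v in
       (- (1 / 3) * v0 + (2 * sqrt 2 / 3) * (w \<bullet> \<tau>),
        ((2 * sqrt 2 / 3) * v0 + (1 / 3) * (w \<bullet> \<tau>)) *\<^sub>R \<tau> - (w \<bullet> \<nu>) *\<^sub>R \<nu>))"

text \<open>
  The walls are the lines at heights \<open>a\<close> and \<open>b\<close>, so the center of a disk of radius \<open>R\<close> is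
  confined to heights between \<open>a + R\<close> and \<open>b - R\<close>.
\<close>

definition in_open_strip :: "real \<Rightarrow> real \<Rightarrow> real \<Rightarrow> plane \<Rightarrow> bool" where
  "in_open_strip R a b q \<longleftrightarrow> a + R < snd q \<and> snd q < b - R"

definition inward_normal :: "real \<Rightarrow> real \<Rightarrow> real \<Rightarrow> plane \<Rightarrow> plane \<Rightarrow> bool" where
  "inward_normal R a b q \<nu> \<longleftrightarrow>
     snd q = a + R \<and> \<nu> = (0, 1) \<or> snd q = b - R \<and> \<nu> = (0, - 1)"

text \<open>
  Free flight from \<open>s\<close> up to the first time \<open>t\<close> at which the center reaches a boundary line,
  followed by the collision there. In particular, the velocity of \<open>s\<close> points into the strip.
\<close>

definition next_collision ::
  "real \<Rightarrow> real \<Rightarrow> real \<Rightarrow> billiard_state \<Rightarrow> billiard_state \<Rightarrow> bool" where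
  "next_collision R a b s s' \<longleftrightarrow>
     (\<exists>t \<nu>. t > 0 \<and>
        (\<forall>r. 0 < r \<and> r < t \<longrightarrow> in_open_strip R a b (center s + r *\<^sub>R snd (velocity s))) \<and>
        center s' = center s + t *\<^sub>R snd (velocity s) \<and>
        inward_normal R a b (center s') \<nu> \<and>
        velocity s' = no_slip_collision \<nu> (velocity s))"

definition no_slip_orbit ::
  "real \<Rightarrow> real \<Rightarrow> real \<Rightarrow> (nat \<Rightarrow> billiard_state) \<Rightarrow> bool" where
  "no_slip_orbit R a b s \<longleftrightarrow>
     (\<exists>\<nu>. inward_normal R a b (center (s 0)) \<nu>) \<and>
     (\<forall>n. next_collision R a b (s n) (s (Suc n)))"

definition has_period :: "(nat \<Rightarrow> billiard_state) \<Rightarrow> nat \<Rightarrow> bool" where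
  "has_period s p \<longleftrightarrow> p \<ge> 1 \<and> (\<forall>n. s (n + p) = s n)"

end

theory Submission
  imports Defs
begin

text \<open>
  Multiplying the horizontal velocity by the sign of the vertical one and pairing the result with
  the rotational velocity gives a complex number that every collision, at either wall, multiplies
  by the same \<open>\<lambda> = (- 1 + 2 * sqrt 2 * \<i>) / 3\<close>. Since \<open>\<lambda>\<close> is not a root of unity, this number
  can recur only if it vanishes.
\<close>

definition collision_multiplier :: complex where
  "collision_multiplier = Complex (- (1 / 3)) (2 * sqrt 2 / 3)"

text \<open>
  In \<open>\<int>[sqrt (- 2)]\<close> the positive powers of \<open>3 * \<lambda>\<close> are all congruent modulo 3, to a nonzero residue;
  the positive powers of 3 are 0 modulo 3.
\<close>

lemma collision_multiplier_power:
  assumes "n \<ge> 1"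
  shows "\<exists>k l. (3 * collision_multiplier) ^ n =
           Complex (of_int (3 * k - 1)) (of_int (3 * l - 1) * sqrt 2)"
  using assms
proof (induction n rule: dec_induct)
  case base
  have "(3 * collision_multiplier) ^ 1 =
          Complex (of_int (3 * 0 - 1)) (of_int (3 * 1 - 1) * sqrt 2)"
    by (simp add: collision_multiplier_def complex_eq_iff)
  then show ?case by blast
next
  case (step n)
  have triple: "3 * collision_multiplier = Complex (- 1) (2 * sqrt 2)"
    by (simp add: collision_multiplier_def complex_eq_iff)
  from step obtain k l where "(3 * collision_multiplier) ^ n =
      Complex (of_int (3 * k - 1)) (of_int (3 * l - 1) * sqrt 2)"
    by blast
  \<comment> \<open>Multiplication by \<open>Complex (- 1) (2 * sqrt 2)\<close> sends coordinates
    \<open>(x, y)\<close> with respect to \<open>1\<close> and \<open>sqrt 2 * \<i>\<close> to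
    \<open>(- x - 4 * y, 2 * x - y)\<close>. Modulo 3, \<open>(- 1, - 1)\<close> goes to
    \<open>(5, - 1)\<close>, which is the same residue.\<close>
  then have "(3 * collision_multiplier) ^ Suc n =
      Complex (of_int (3 * (2 - k - 4 * l) - 1)) (of_int (3 * (2 * k - l) - 1) * sqrt 2)"
    by (simp only: power_Suc triple) (simp add: complex_eq_iff algebra_simps)
  then show ?case by blast
qed

lemma collision_multiplier_not_root_of_unity:
  assumes "n \<ge> 1"
  shows "collision_multiplier ^ n \<noteq> 1"
proof
  assume unity: "collision_multiplier ^ n = 1"
  obtain k l where kl: "(3 * collision_multiplier) ^ n =
      Complex (of_int (3 * k - 1)) (of_int (3 * l - 1) * sqrt 2)"
    using collision_multiplier_power[OF assms] by blast
  \<comment> \<open>Clearing the denominator turns the assumed root of unity into an integer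
    identity; its real part contradicts the residue \<open>- 1\<close> modulo 3.\<close>
  have "(3 * collision_multiplier) ^ n = of_int (3 ^ n)"
    using unity by (simp add: power_mult_distrib)
  then have "real_of_int (3 ^ n) = of_int (3 * k - 1)"
    using kl by (metis complex.sel(1) Re_complex_of_real of_real_of_int_eq)
  then have "(3::int) ^ n = 3 * k - 1"
    by (simp only: of_int_eq_iff)
  moreover have "(3::int) dvd 3 ^ n"
    using assms by simp
  ultimately show False
    by presburger
qed

definition signed_velocity :: "velocity \<Rightarrow> complex" where
  "signed_velocity v = Complex (rotational v) (sgn (vertical v) * horizontal v)"

lemma vertical_no_slip_collision:
  assumes "\<bar>\<sigma>\<bar> = 1"
  shows "vertical (no_slip_collision (0, \<sigma>) v) = - vertical v"
  using assms
  by (auto simp: no_slip_collision_def rotate_right_def inner_prod_def Let_def abs_if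
      split: if_splits)

text \<open>On the pair formed by \<open>v0\<close> and \<open>w \<bullet> \<tau>\<close> the
  collision acts as a reflection. Since \<open>\<tau>\<close> is \<open>(\<sigma>, 0)\<close>, the
  signed horizontal velocity is \<open>- (w \<bullet> \<tau>)\<close> before the collision and
  \<open>w \<bullet> \<tau>\<close> after it. This extra sign turns the reflection into a rotation,
  the same one at both walls.\<close>

lemma signed_velocity_no_slip_collision:
  assumes "\<bar>\<sigma>\<bar> = 1" and "sgn (vertical v) = - \<sigma>"
  shows "signed_velocity (no_slip_collision (0, \<sigma>) v) = collision_multiplier * signed_velocity v"
proof -
  have "\<sigma> = 1 \<or> \<sigma> = - 1"
    using assms(1) by linarith
  then show ?thesis
    using assms(2) vertical_no_slip_collision[OF assms(1), of v]
    by (auto simp: signed_velocity_def collision_multiplier_def complex_eq_iff sgn_minus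
        no_slip_collision_def rotate_right_def inner_prod_def Let_def algebra_simps)
qed

text \<open>A flight that starts on one wall leaves it and can only end on the other, and the
  heights \<open>a + R\<close> and \<open>b - R\<close> add up to \<open>a + b\<close>. Here
  \<open>(0, \<sigma>)\<close> is the inward normal of the wall reached, so the incoming vertical
  velocity has sign \<open>- \<sigma>\<close>.\<close>

lemma next_collision_at_opposite_wall:
  assumes "inward_normal R a b (center s) \<nu>" and "next_collision R a b s s'"
  obtains t \<sigma> where "\<bar>\<sigma>\<bar> = 1" and "sgn (vertical (velocity s)) = - \<sigma>"
    and "center s' = center s + t *\<^sub>R snd (velocity s)"
    and "snd (center s') = a + b - snd (center s)"
    and "velocity s' = no_slip_collision (0, \<sigma>) (velocity s)"
proof -
  let ?v = "vertical (velocity s)"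
  obtain t \<nu>' where t: "t > 0"
    and open_strip:
      "\<forall>r. 0 < r \<and> r < t \<longrightarrow> in_open_strip R a b (center s + r *\<^sub>R snd (velocity s))"
    and center': "center s' = center s + t *\<^sub>R snd (velocity s)"
    and normal': "inward_normal R a b (center s') \<nu>'"
    and velocity': "velocity s' = no_slip_collision \<nu>' (velocity s)"
    using assms(2) unfolding next_collision_def by blast
  \<comment> \<open>The midpoint of the flight lies strictly inside the strip. This rules out
    sliding along the wall and fixes the sign of the vertical velocity.\<close>
  have "in_open_strip R a b (center s + (t / 2) *\<^sub>R snd (velocity s))"
    using open_strip t by simp
  then have inside: "a + R < snd (center s) + t / 2 * ?v" "snd (center s) + t / 2 * ?v < b - R"
    by (simp_all add: in_open_strip_def)
  have snd_center': "snd (center s') = snd (center s) + t * ?v"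
    using center' by simp
  consider "snd (center s) = a + R" | "snd (center s) = b - R"
    using assms(1) by (auto simp: inward_normal_def)
  then show thesis
  proof cases
    case 1
    then have "?v > 0"
      using inside(1) t by (simp add: zero_less_mult_iff)
    then have "snd (center s') > a + R"
      using 1 t snd_center' by simp
    then have "snd (center s') = b - R" "\<nu>' = (0, - 1)"
      using normal' by (auto simp: inward_normal_def)
    then show thesis
      using that[of "- 1" t] \<open>?v > 0\<close> 1 center' velocity' by simp
  next
    case 2
    then have "?v < 0"
      using inside(2) t by (simp add: mult_less_0_iff)
    then have "snd (center s') < b - R"
      using 2 t snd_center' by (simp add: mult_less_0_iff)
    then have "snd (center s') = a + R" "\<nu>' = (0, 1)"
      using normal' by (auto simp: inward_normal_def)
    then show thesis
      using that[of 1 t] \<open>?v < 0\<close> 2 center' velocity' by simp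
  qed
qed

lemma no_slip_orbit_normal:
  assumes "no_slip_orbit R a b s"
  obtains \<nu> where "inward_normal R a b (center (s n)) \<nu>"
proof (cases n)
  case 0
  then show thesis
    using assms that unfolding no_slip_orbit_def by blast
next
  case (Suc m)
  have "next_collision R a b (s m) (s (Suc m))"
    using assms by (simp add: no_slip_orbit_def)
  then show thesis
    using Suc that unfolding next_collision_def by blast
qed

lemma no_slip_orbit_step:
  assumes "no_slip_orbit R a b s"
  shows "vertical (velocity (s n)) \<noteq> 0"
    and "vertical (velocity (s (Suc n))) = - vertical (velocity (s n))"
    and "signed_velocity (velocity (s (Suc n))) =
           collision_multiplier * signed_velocity (velocity (s n))"
    and "snd (center (s (Suc n))) = a + b - snd (center (s n))"
    and "horizontal (velocity (s n)) = 0 \<Longrightarrow> fst (center (s (Suc n))) = fst (center (s n))"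
proof -
  obtain \<nu> where "inward_normal R a b (center (s n)) \<nu>"
    using no_slip_orbit_normal[OF assms] .
  moreover have "next_collision R a b (s n) (s (Suc n))"
    using assms by (simp add: no_slip_orbit_def)
  ultimately obtain t \<sigma> where \<sigma>: "\<bar>\<sigma>\<bar> = 1" "sgn (vertical (velocity (s n))) = - \<sigma>"
    and center': "center (s (Suc n)) = center (s n) + t *\<^sub>R snd (velocity (s n))"
    and snd_center': "snd (center (s (Suc n))) = a + b - snd (center (s n))"
    and velocity': "velocity (s (Suc n)) = no_slip_collision (0, \<sigma>) (velocity (s n))"
    by (rule next_collision_at_opposite_wall)
  show "vertical (velocity (s n)) \<noteq> 0"
    using \<sigma> by auto
  show "vertical (velocity (s (Suc n))) = - vertical (velocity (s n))"
    using vertical_no_slip_collision[OF \<sigma>(1)] velocity' by simp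
  show "signed_velocity (velocity (s (Suc n))) =
          collision_multiplier * signed_velocity (velocity (s n))"
    using signed_velocity_no_slip_collision[OF \<sigma>] velocity' by simp
  show "snd (center (s (Suc n))) = a + b - snd (center (s n))"
    by (fact snd_center')
  show "fst (center (s (Suc n))) = fst (center (s n))" if "horizontal (velocity (s n)) = 0"
    using center' that by simp
qed

lemma signed_velocity_orbit:
  assumes "no_slip_orbit R a b s"
  shows "signed_velocity (velocity (s n)) =
           collision_multiplier ^ n * signed_velocity (velocity (s 0))"
  by (induction n) (simp_all add: no_slip_orbit_step(3)[OF assms])

theorem proposition2p4:
  fixes R a b :: real and s :: "nat \<Rightarrow> billiard_state"
  assumes "R > 0" and "a + R < b - R"
    and "no_slip_orbit R a b s"
    and "vertical (velocity (s 0)) \<noteq> 0"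
    and "\<exists>p. has_period s p"
  shows "(\<forall>n. rotational (velocity (s n)) = 0 \<and> horizontal (velocity (s n)) = 0) \<and>
         (\<forall>n. fst (center (s n)) = fst (center (s 0))) \<and>
         has_period s 2 \<and> \<not> has_period s 1"
proof -
  note step = no_slip_orbit_step[OF assms(3)]
  note iterate = signed_velocity_orbit[OF assms(3)]
  obtain p where p: "p \<ge> 1" "s p = s 0"
    using assms(5) unfolding has_period_def by (metis add_0)
  \<comment> \<open>Periodicity gives \<open>z = collision_multiplier ^ p * z\<close> for the
    initial signed velocity \<open>z\<close>, with a factor different from 1.\<close>
  have "signed_velocity (velocity (s 0)) = 0"
    using iterate[of p] p collision_multiplier_not_root_of_unity[OF p(1)] by simp
  then have signed_zero: "signed_velocity (velocity (s n)) = 0" for n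
    using iterate[of n] by simp
  \<comment> \<open>The sign in the imaginary part is nonzero because the vertical velocity is, so
    the horizontal velocity itself vanishes.\<close>
  have still: "rotational (velocity (s n)) = 0" "horizontal (velocity (s n)) = 0" for n
    using signed_zero[of n] step(1)[of n]
    by (simp_all add: signed_velocity_def complex_eq_iff sgn_zero_iff)
  have fst_center: "fst (center (s n)) = fst (center (s 0))" for n
    by (induction n) (simp_all add: step(5) still)
  \<comment> \<open>Two collisions undo both the reflection of the height and the change of sign of
    the vertical velocity; the other components are constant.\<close>
  have "s (n + 2) = s n" for n
  proof -
    have "center (s (n + 2)) = center (s n)"
      using fst_center[of n] fst_center[of "n + 2"] step(4)[of n] step(4)[of "Suc n"]
      by (simp add: prod_eq_iff)
    moreover have "velocity (s (n + 2)) = velocity (s n)"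
      using still[of n] still[of "n + 2"] step(2)[of n] step(2)[of "Suc n"]
      by (simp add: prod_eq_iff)
    ultimately show ?thesis
      by simp
  qed
  then have "has_period s 2"
    by (simp add: has_period_def)
  \<comment> \<open>A nonzero vertical velocity changes sign at the collision, so successive states
    differ.\<close>
  moreover have "s (0 + 1) \<noteq> s 0"
    using step(1,2)[of 0] by auto
  then have "\<not> has_period s 1"
    unfolding has_period_def by blast
  ultimately show ?thesis
    using still fst_center by blast
qed

end
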